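(* Let $a,b$ be real numbers with $b>a\geqslant 0$, and let $\langle\alpha_n\rangle_{n>0}$ be a sequence of positive real numbers such that $\sum_{n>0}\alpha_n$ converges and, for every $n>0$, $\sum_{i>n}\alpha_i<\alpha_n(1-a/b)$. Let $\boldsymbol\psi_1,\boldsymbol\psi_2,\dots$ be a list of all the sentences of the fixed countable language. For a theory $T$ put $$\sigma_n^{\langle a,b\rangle}(T)=\begin{cases}a&\text{if }T\nvdash\boldsymbol\psi_n,\\ b&\text{if }T\vdash\boldsymbol\psi_n,\end{cases}\qquad \mathscr{V}^{\langle a,b\rangle}_{\alpha}(T)=\sum_{n>0}\alpha_n\,\sigma_n^{\langle a,b\rangle}(T).$$ Then $\mathscr{V}^{\langle a,b\rangle}_{\alpha}$ satisfies both HP and EP for all theories; that is, for all theories $T$ and $U$: (HP) if $\mathscr{V}^{\langle a,b\rangle}_{\alpha}(U)>\mathscr{V}^{\langle a,b\rangle}_{\alpha}(T)$ then $T\nvdash U$; and (EP) if $\mathscr{V}^{\langle a,b\rangle}_{\alpha}(T)=\mathscr{V}^{\langle a,b\rangle}_{\alpha}(U)$ then $T\equiv U$.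
   Context: Fix a countable language and classical (propositional or first-order) logic over it. A theory is an arbitrary set of sentences. $T\vdash\psi$ means $\psi$ is provable from $T$; for theories $T,U$, $T\vdash U$ means $T$ proves every sentence in $U$, and $T\equiv U$ means $T\vdash U$ and $U\vdash T$. *)

theory Defs
  imports Complex_Main "HOL-Library.Countable_Set"
begin

section \<open>Propositional logic over a set of atoms\<close>

text \<open>Falsum and implication are primitive; the other connectives are definable from them.
  The calculus is a Hilbert system, and derivations stay within the given language.\<close>

datatype 'p pform = PAtom 'p | PBot | PImp "'p pform" "'p pform"

fun atoms :: "'p pform \<Rightarrow> 'p set" where
  "atoms (PAtom p) = {p}"
| "atoms PBot = {}"
| "atoms (PImp \<phi> \<psi>) = atoms \<phi> \<union> atoms \<psi>"

definition prop_sentences :: "'p set \<Rightarrow> 'p pform set" where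
  "prop_sentences A = {\<phi>. atoms \<phi> \<subseteq> A}"

inductive prop_provable :: "'p set \<Rightarrow> 'p pform set \<Rightarrow> 'p pform \<Rightarrow> bool"
  for A :: "'p set" and T :: "'p pform set" where
  PAssm: "\<phi> \<in> T \<Longrightarrow> prop_provable A T \<phi>"
| PK: "\<lbrakk>\<phi> \<in> prop_sentences A; \<psi> \<in> prop_sentences A\<rbrakk>
    \<Longrightarrow> prop_provable A T (PImp \<phi> (PImp \<psi> \<phi>))"
| PS: "\<lbrakk>\<phi> \<in> prop_sentences A; \<psi> \<in> prop_sentences A; \<chi> \<in> prop_sentences A\<rbrakk>
    \<Longrightarrow> prop_provable A T
          (PImp (PImp \<phi> (PImp \<psi> \<chi>)) (PImp (PImp \<phi> \<psi>) (PImp \<phi> \<chi>)))"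
| PDN: "\<phi> \<in> prop_sentences A
    \<Longrightarrow> prop_provable A T (PImp (PImp (PImp \<phi> PBot) PBot) \<phi>)"
| PMP: "\<lbrakk>prop_provable A T (PImp \<phi> \<psi>); prop_provable A T \<phi>\<rbrakk> \<Longrightarrow> prop_provable A T \<psi>"


section \<open>First-order logic over a language\<close>

text \<open>Constants are function symbols of arity 0. The flag \<open>has_eq\<close> says whether identity
  belongs to the logic, so that first-order logic with and without identity are both covered.\<close>

record ('f, 'r) language =
  funs :: "'f set"
  fun_arity :: "'f \<Rightarrow> nat"
  rels :: "'r set"
  rel_arity :: "'r \<Rightarrow> nat"
  has_eq :: bool

definition countable_language :: "('f, 'r) language \<Rightarrow> bool" where
  "countable_language L \<longleftrightarrow> countable (funs L) \<and> countable (rels L)"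

datatype 'f trm = Var nat | Fn 'f "'f trm list"

datatype ('f, 'r) form =
    Bot
  | Eq "'f trm" "'f trm"
  | Rel 'r "'f trm list"
  | Imp "('f, 'r) form" "('f, 'r) form"
  | All nat "('f, 'r) form"

fun wf_trm :: "('f, 'r) language \<Rightarrow> 'f trm \<Rightarrow> bool" where
  "wf_trm L (Var x) \<longleftrightarrow> True"
| "wf_trm L (Fn f ts) \<longleftrightarrow>
    f \<in> funs L \<and> length ts = fun_arity L f \<and> (\<forall>t \<in> set ts. wf_trm L t)"

fun wf_form :: "('f, 'r) language \<Rightarrow> ('f, 'r) form \<Rightarrow> bool" where
  "wf_form L Bot \<longleftrightarrow> True"
| "wf_form L (Eq s t) \<longleftrightarrow> has_eq L \<and> wf_trm L s \<and> wf_trm L t"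
| "wf_form L (Rel r ts) \<longleftrightarrow>
    r \<in> rels L \<and> length ts = rel_arity L r \<and> (\<forall>t \<in> set ts. wf_trm L t)"
| "wf_form L (Imp \<phi> \<psi>) \<longleftrightarrow> wf_form L \<phi> \<and> wf_form L \<psi>"
| "wf_form L (All x \<phi>) \<longleftrightarrow> wf_form L \<phi>"

fun fv_trm :: "'f trm \<Rightarrow> nat set" where
  "fv_trm (Var x) = {x}"
| "fv_trm (Fn f ts) = (\<Union>t \<in> set ts. fv_trm t)"

fun fv :: "('f, 'r) form \<Rightarrow> nat set" where
  "fv Bot = {}"
| "fv (Eq s t) = fv_trm s \<union> fv_trm t"
| "fv (Rel r ts) = (\<Union>t \<in> set ts. fv_trm t)"
| "fv (Imp \<phi> \<psi>) = fv \<phi> \<union> fv \<psi>"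
| "fv (All x \<phi>) = fv \<phi> - {x}"

definition fo_sentences :: "('f, 'r) language \<Rightarrow> ('f, 'r) form set" where
  "fo_sentences L = {\<phi>. wf_form L \<phi> \<and> fv \<phi> = {}}"

fun subst_trm :: "nat \<Rightarrow> 'f trm \<Rightarrow> 'f trm \<Rightarrow> 'f trm" where
  "subst_trm x u (Var y) = (if y = x then u else Var y)"
| "subst_trm x u (Fn f ts) = Fn f (map (subst_trm x u) ts)"

text \<open>Substitution replaces the free occurrences without renaming bound variables; it is only
  used under the side condition \<open>free_for\<close>, which excludes variable capture.\<close>

fun subst :: "nat \<Rightarrow> 'f trm \<Rightarrow> ('f, 'r) form \<Rightarrow> ('f, 'r) form" where
  "subst x u Bot = Bot"
| "subst x u (Eq s t) = Eq (subst_trm x u s) (subst_trm x u t)"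
| "subst x u (Rel r ts) = Rel r (map (subst_trm x u) ts)"
| "subst x u (Imp \<phi> \<psi>) = Imp (subst x u \<phi>) (subst x u \<psi>)"
| "subst x u (All y \<phi>) = (if y = x then All y \<phi> else All y (subst x u \<phi>))"

fun free_for :: "'f trm \<Rightarrow> nat \<Rightarrow> ('f, 'r) form \<Rightarrow> bool" where
  "free_for u x Bot \<longleftrightarrow> True"
| "free_for u x (Eq s t) \<longleftrightarrow> True"
| "free_for u x (Rel r ts) \<longleftrightarrow> True"
| "free_for u x (Imp \<phi> \<psi>) \<longleftrightarrow> free_for u x \<phi> \<and> free_for u x \<psi>"
| "free_for u x (All y \<phi>) \<longleftrightarrow> x \<notin> fv (All y \<phi>) \<or> (y \<notin> fv_trm u \<and> free_for u x \<phi>)"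

text \<open>A Hilbert system in the style of Mendelson. Generalization is unrestricted, which is
  harmless because theories consist of sentences.\<close>

inductive fo_provable ::
    "('f, 'r) language \<Rightarrow> ('f, 'r) form set \<Rightarrow> ('f, 'r) form \<Rightarrow> bool"
  for L :: "('f, 'r) language" and T :: "('f, 'r) form set" where
  Assm: "\<phi> \<in> T \<Longrightarrow> fo_provable L T \<phi>"
| K: "\<lbrakk>wf_form L \<phi>; wf_form L \<psi>\<rbrakk> \<Longrightarrow> fo_provable L T (Imp \<phi> (Imp \<psi> \<phi>))"
| S: "\<lbrakk>wf_form L \<phi>; wf_form L \<psi>; wf_form L \<chi>\<rbrakk>
    \<Longrightarrow> fo_provable L T (Imp (Imp \<phi> (Imp \<psi> \<chi>)) (Imp (Imp \<phi> \<psi>) (Imp \<phi> \<chi>)))"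
| DN: "wf_form L \<phi> \<Longrightarrow> fo_provable L T (Imp (Imp (Imp \<phi> Bot) Bot) \<phi>)"
| Inst: "\<lbrakk>wf_form L \<phi>; wf_trm L t; free_for t x \<phi>\<rbrakk>
    \<Longrightarrow> fo_provable L T (Imp (All x \<phi>) (subst x t \<phi>))"
| Distr: "\<lbrakk>wf_form L \<phi>; wf_form L \<psi>; x \<notin> fv \<phi>\<rbrakk>
    \<Longrightarrow> fo_provable L T (Imp (All x (Imp \<phi> \<psi>)) (Imp \<phi> (All x \<psi>)))"
| EqRefl: "\<lbrakk>has_eq L; wf_trm L t\<rbrakk> \<Longrightarrow> fo_provable L T (Eq t t)"
| EqSubst: "\<lbrakk>has_eq L; wf_form L \<phi>; wf_trm L s; wf_trm L t; free_for s x \<phi>; free_for t x \<phi>\<rbrakk>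
    \<Longrightarrow> fo_provable L T (Imp (Eq s t) (Imp (subst x s \<phi>) (subst x t \<phi>)))"
| MP: "\<lbrakk>fo_provable L T (Imp \<phi> \<psi>); fo_provable L T \<phi>\<rbrakk> \<Longrightarrow> fo_provable L T \<psi>"
| Gen: "fo_provable L T \<phi> \<Longrightarrow> fo_provable L T (All x \<phi>)"


section \<open>Theories and valuations\<close>

text \<open>The notions below are parametrized by a provability relation \<open>prov\<close> and, where they
  quantify over theories, by the set \<open>S\<close> of all sentences.\<close>

definition proves_theory :: "('s set \<Rightarrow> 's \<Rightarrow> bool) \<Rightarrow> 's set \<Rightarrow> 's set \<Rightarrow> bool" where
  "proves_theory prov T U \<longleftrightarrow> (\<forall>\<psi> \<in> U. prov T \<psi>)"

definition equiv_theory :: "('s set \<Rightarrow> 's \<Rightarrow> bool) \<Rightarrow> 's set \<Rightarrow> 's set \<Rightarrow> bool" where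
  "equiv_theory prov T U \<longleftrightarrow> proves_theory prov T U \<and> proves_theory prov U T"

definition sigma ::
    "('s set \<Rightarrow> 's \<Rightarrow> bool) \<Rightarrow> (nat \<Rightarrow> 's) \<Rightarrow> real \<Rightarrow> real \<Rightarrow> nat \<Rightarrow> 's set \<Rightarrow> real" where
  "sigma prov \<psi> a b n T = (if prov T (\<psi> n) then b else a)"

text \<open>Sequences are indexed by the positive integers; their value at 0 is irrelevant.\<close>

definition valuation ::
    "('s set \<Rightarrow> 's \<Rightarrow> bool) \<Rightarrow> (nat \<Rightarrow> 's) \<Rightarrow> real \<Rightarrow> real \<Rightarrow> (nat \<Rightarrow> real) \<Rightarrow> 's set \<Rightarrow> real" where
  "valuation prov \<psi> a b \<alpha> T = (\<Sum>n. \<alpha> (Suc n) * sigma prov \<psi> a b (Suc n) T)"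

definition HP :: "'s set \<Rightarrow> ('s set \<Rightarrow> 's \<Rightarrow> bool) \<Rightarrow> ('s set \<Rightarrow> real) \<Rightarrow> bool" where
  "HP S prov V \<longleftrightarrow>
    (\<forall>T U. T \<subseteq> S \<and> U \<subseteq> S \<and> V U > V T \<longrightarrow> \<not> proves_theory prov T U)"

definition EP :: "'s set \<Rightarrow> ('s set \<Rightarrow> 's \<Rightarrow> bool) \<Rightarrow> ('s set \<Rightarrow> real) \<Rightarrow> bool" where
  "EP S prov V \<longleftrightarrow>
    (\<forall>T U. T \<subseteq> S \<and> U \<subseteq> S \<and> V T = V U \<longrightarrow> equiv_theory prov T U)"

end

theory Submission
  imports Defs
begin

text \<open>A valuation is monotone in the set of listed sentences that the theory proves, and cut
  makes this set monotone in the deductive strength of the theory; this gives HP. For EP, compare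
  two theories at the first listed sentence on which they differ, with index \<open>n\<close>: this sentence
  contributes \<open>\<alpha>\<^sub>n(b - a)\<close> to the difference of the values, while all later ones together contribute
  less than that in absolute value, because \<open>\<alpha>\<^sub>n\<close> exceeds the tail of the series.\<close>

lemma summable_mult_two_valued:
  fixes \<beta> :: "nat \<Rightarrow> real"
  assumes "summable \<beta>" and "\<And>n. \<beta> n > 0"
  shows "summable (\<lambda>n. \<beta> n * (if P n then b else a))"
proof (rule summable_comparison_test')
  \<comment> \<open>The factor \<open>\<bar>a\<bar> + \<bar>b\<bar>\<close> dominates both possible
    values, whatever the signs of \<open>a\<close> and \<open>b\<close>.\<close>
  show "summable (\<lambda>n. \<beta> n * (\<bar>a\<bar> + \<bar>b\<bar>))"
    using assms(1) by (rule summable_mult2)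
  show "norm (\<beta> n * (if P n then b else a)) \<le> \<beta> n * (\<bar>a\<bar> + \<bar>b\<bar>)" if "n \<ge> 0" for n
    using assms(2)[of n] by (auto simp: abs_mult intro!: mult_left_mono)
qed

lemma suminf_two_valued_less:
  fixes \<beta> :: "nat \<Rightarrow> real"
  assumes sm: "summable \<beta>" and pos: "\<And>n. \<beta> n > 0"
    and tail: "(\<Sum>i. \<beta> (i + Suc n)) < \<beta> n"
    and "a < b" and eq: "\<And>i. i < n \<Longrightarrow> P i = Q i" and "P n" "\<not> Q n"
  shows "(\<Sum>i. \<beta> i * (if Q i then b else a)) < (\<Sum>i. \<beta> i * (if P i then b else a))"
proof -
  define d where "d i = \<beta> i * (if P i then b else a) - \<beta> i * (if Q i then b else a)" for i
  note sum2 = summable_mult_two_valued[OF sm pos]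
  have sd: "summable d"
    unfolding d_def by (intro summable_diff sum2)
  \<comment> \<open>Worst case for the tail: \<open>Q\<close> holds and \<open>P\<close> fails at
    every later index, so that each term of \<open>d\<close> equals
    \<open>- (b - a) * \<beta>\<close>.\<close>
  have "(\<Sum>i. - (b - a) * \<beta> (i + Suc n)) \<le> (\<Sum>i. d (i + Suc n))"
  proof (rule suminf_le)
    show "- (b - a) * \<beta> (i + Suc n) \<le> d (i + Suc n)" for i
      using pos[of "i + Suc n"] \<open>a < b\<close> by (auto simp: d_def algebra_simps)
    show "summable (\<lambda>i. - (b - a) * \<beta> (i + Suc n))"
      by (intro summable_mult summable_ignore_initial_segment sm)
    show "summable (\<lambda>i. d (i + Suc n))"
      by (intro summable_ignore_initial_segment sd)
  qed
  also have "(\<Sum>i. - (b - a) * \<beta> (i + Suc n)) = - (b - a) * (\<Sum>i. \<beta> (i + Suc n))"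
    by (intro suminf_mult summable_ignore_initial_segment sm)
  finally have "- (b - a) * (\<Sum>i. \<beta> (i + Suc n)) \<le> (\<Sum>i. d (i + Suc n))" .
  moreover have "(b - a) * (\<Sum>i. \<beta> (i + Suc n)) < (b - a) * \<beta> n"
    using tail \<open>a < b\<close> by simp
  \<comment> \<open>The terms below \<open>n\<close> cancel by \<open>eq\<close>; the segment of
    length \<open>Suc n\<close> still includes the term at \<open>n\<close>, the only one that
    survives.\<close>
  moreover have "(\<Sum>i<Suc n. d i) = (b - a) * \<beta> n"
    using eq \<open>P n\<close> \<open>\<not> Q n\<close> by (simp add: d_def algebra_simps)
  ultimately have "0 < (\<Sum>i. d i)"
    using suminf_split_initial_segment[OF sd, of "Suc n"] by linarith
  also have "(\<Sum>i. d i) = (\<Sum>i. \<beta> i * (if P i then b else a)) - (\<Sum>i. \<beta> i * (if Q i then b else a))"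
    unfolding d_def by (intro suminf_diff[symmetric] sum2)
  finally show ?thesis by simp
qed

text \<open>At the least index where \<open>P\<close> and \<open>Q\<close> differ, one of them holds
  and the other fails; whichever holds there has the strictly larger sum.\<close>

lemma suminf_two_valued_inject:
  fixes \<beta> :: "nat \<Rightarrow> real"
  assumes "summable \<beta>" and "\<And>n. \<beta> n > 0"
    and "\<And>n. (\<Sum>i. \<beta> (i + Suc n)) < \<beta> n" and "a < b"
    and eq: "(\<Sum>i. \<beta> i * (if P i then b else a)) = (\<Sum>i. \<beta> i * (if Q i then b else a))"
  shows "P = Q"
proof (rule ccontr)
  assume "P \<noteq> Q"
  then obtain m where "P m \<noteq> Q m" by blast
  define n where "n = (LEAST n. P n \<noteq> Q n)"
  have differ: "P n \<noteq> Q n"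
    unfolding n_def by (rule LeastI) fact
  have agree: "P i = Q i" if "i < n" for i
    using not_less_Least that unfolding n_def by blast
  show False
  proof (cases "P n")
    case True
    then show False
      using suminf_two_valued_less[of \<beta> n a b P Q] assms differ agree by simp
  next
    case False
    then show False
      using suminf_two_valued_less[of \<beta> n a b Q P] assms differ agree by simp
  qed
qed

text \<open>By contraposition: if \<open>T\<close> proves \<open>U\<close>, cut makes every term of
  the series for \<open>U\<close> at most the corresponding term for \<open>T\<close>.\<close>

lemma valuation_HP:
  assumes cut: "\<And>T U \<chi>. \<lbrakk>proves_theory prov T U; prov U \<chi>\<rbrakk> \<Longrightarrow> prov T \<chi>"
    and "a < b" and pos: "\<forall>n>0. \<alpha> n > 0" and sm: "summable (\<lambda>n. \<alpha> (Suc n))"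
  shows "HP S prov (valuation prov \<psi> a b \<alpha>)"
proof -
  have "valuation prov \<psi> a b \<alpha> U \<le> valuation prov \<psi> a b \<alpha> T" if "proves_theory prov T U" for T U
    unfolding valuation_def sigma_def
    using cut[OF that] \<open>a < b\<close> pos sm
    by (intro suminf_le summable_mult_two_valued mult_left_mono) (auto simp: less_imp_le)
  then show ?thesis
    unfolding HP_def by (meson not_le)
qed

text \<open>Equal values force \<open>T\<close> and \<open>U\<close> to prove the same listed
  sentences. The members of each theory are listed and provable from it, hence provable from the
  other.\<close>

lemma valuation_EP:
  assumes assm: "\<And>T \<chi>. \<chi> \<in> T \<Longrightarrow> prov T \<chi>"
    and "a < b" and pos: "\<forall>n>0. \<alpha> n > 0" and sm: "summable (\<lambda>n. \<alpha> (Suc n))"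
    and tail: "\<forall>n>0. (\<Sum>i. \<alpha> (n + 1 + i)) < \<alpha> n"
    and list: "S \<subseteq> \<psi> ` {0<..}"
  shows "EP S prov (valuation prov \<psi> a b \<alpha>)"
  unfolding EP_def
proof (intro allI impI)
  fix T U
  assume *: "T \<subseteq> S \<and> U \<subseteq> S \<and> valuation prov \<psi> a b \<alpha> T = valuation prov \<psi> a b \<alpha> U"
  \<comment> \<open>Shift from positive indices to all naturals: the tail beyond
    \<open>\<alpha> (Suc n)\<close> starts at \<open>\<alpha> (n + 2)\<close>.\<close>
  have "(\<Sum>i. \<alpha> (Suc (i + Suc n))) < \<alpha> (Suc n)" for n
    using tail[rule_format, of "Suc n"] by (simp add: add.commute)
  then have "(\<lambda>n. prov T (\<psi> (Suc n))) = (\<lambda>n. prov U (\<psi> (Suc n)))"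
    using * pos sm \<open>a < b\<close> unfolding valuation_def sigma_def
    by (intro suminf_two_valued_inject[where \<beta> = "\<lambda>n. \<alpha> (Suc n)" and a = a and b = b]) auto
  then have "prov T (\<psi> n) = prov U (\<psi> n)" if "n > 0" for n
    using that by (metis gr0_implies_Suc)
  then have "\<forall>\<chi> \<in> \<psi> ` {0<..}. prov T \<chi> = prov U \<chi>" by simp
  then have "prov T \<chi> = prov U \<chi>" if "\<chi> \<in> S" for \<chi>
    using list that by blast
  then show "equiv_theory prov T U"
    using * assm unfolding equiv_theory_def proves_theory_def by blast
qed

text \<open>In a derivation from \<open>U\<close>, each assumption is replaced by its derivation
  from \<open>T\<close>; the axioms and modus ponens do not refer to the theory.\<close>

lemma prop_provable_cut:
  assumes "proves_theory (prop_provable A) T U" and "prop_provable A U \<chi>"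
  shows "prop_provable A T \<chi>"
  using assms(2,1) unfolding proves_theory_def
  by (induction rule: prop_provable.induct) (auto intro: prop_provable.intros)

text \<open>The same replacement works here because \<open>Gen\<close> is unrestricted: it puts no
  condition on the assumptions used.\<close>

lemma fo_provable_cut:
  assumes "proves_theory (fo_provable L) T U" and "fo_provable L U \<chi>"
  shows "fo_provable L T \<chi>"
  using assms(2,1) unfolding proves_theory_def
  by (induction rule: fo_provable.induct) (auto intro: fo_provable.intros)

theorem theoremI3p12:
  fixes a b :: real and \<alpha> :: "nat \<Rightarrow> real"
    and A :: "'p set" and \<phi> :: "nat \<Rightarrow> 'p pform"
    and L :: "('f, 'r) language" and \<psi> :: "nat \<Rightarrow> ('f, 'r) form"
  assumes "b > a" and "a \<ge> 0"
    and "\<forall>n>0. \<alpha> n > 0"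
    and "summable (\<lambda>n. \<alpha> (Suc n))"
    and "\<forall>n>0. (\<Sum>i. \<alpha> (n + 1 + i)) < \<alpha> n * (1 - a / b)"
  shows "(countable A \<and> \<phi> ` {0<..} = prop_sentences A \<longrightarrow>
           HP (prop_sentences A) (prop_provable A) (valuation (prop_provable A) \<phi> a b \<alpha>) \<and>
           EP (prop_sentences A) (prop_provable A) (valuation (prop_provable A) \<phi> a b \<alpha>)) \<and>
         (countable_language L \<and> \<psi> ` {0<..} = fo_sentences L \<longrightarrow>
           HP (fo_sentences L) (fo_provable L) (valuation (fo_provable L) \<psi> a b \<alpha>) \<and>
           EP (fo_sentences L) (fo_provable L) (valuation (fo_provable L) \<psi> a b \<alpha>))"
proof -
  \<comment> \<open>From \<open>0 \<le> a < b\<close> the factor \<open>1 - a / b\<close> is at most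
    1.\<close>
  have tail: "\<forall>n>0. (\<Sum>i. \<alpha> (n + 1 + i)) < \<alpha> n"
  proof (intro allI impI)
    fix n :: nat assume "n > 0"
    then have "(\<Sum>i. \<alpha> (n + 1 + i)) < \<alpha> n * (1 - a / b)" and "\<alpha> n > 0"
      using assms(3,5) by blast+
    moreover have "\<alpha> n * (1 - a / b) \<le> \<alpha> n * 1"
      using assms(1,2) \<open>\<alpha> n > 0\<close> by (intro mult_left_mono) auto
    ultimately show "(\<Sum>i. \<alpha> (n + 1 + i)) < \<alpha> n" by linarith
  qed
  \<comment> \<open>The first premise stays open for the property specific to each calculus: cut for
    HP, provability of assumptions for EP.\<close>
  note HP = valuation_HP[OF _ assms(1,3,4)]
    and EP = valuation_EP[OF _ assms(1,3,4) tail]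
  show ?thesis
  proof (intro conjI impI)
    assume *: "countable A \<and> \<phi> ` {0<..} = prop_sentences A"
    show "HP (prop_sentences A) (prop_provable A) (valuation (prop_provable A) \<phi> a b \<alpha>)"
      by (rule HP[OF prop_provable_cut])
    show "EP (prop_sentences A) (prop_provable A) (valuation (prop_provable A) \<phi> a b \<alpha>)"
      using * by (intro EP[OF prop_provable.PAssm]) auto
  next
    assume *: "countable_language L \<and> \<psi> ` {0<..} = fo_sentences L"
    show "HP (fo_sentences L) (fo_provable L) (valuation (fo_provable L) \<psi> a b \<alpha>)"
      by (rule HP[OF fo_provable_cut])
    show "EP (fo_sentences L) (fo_provable L) (valuation (fo_provable L) \<psi> a b \<alpha>)"
      using * by (intro EP[OF fo_provable.Assm]) auto
  qed
qed

end
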